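(* Let $\ell_{\mathrm{LS}}(d,c):=\|d-c\|_2^2$ and let $\mathcal{P}$ be the class of all distributions $\mathbb{P}$ on $W\times C$ such that for all $w\in W$ the conditional distribution $\mathbb{P}[\cdot\mid w]$ of $c$ is square integrable and $\mathbb{E}[c\mid w]\in\operatorname{Conv}(C)$. Let $B_X:=\max_{x,x'\in X}\|x-x'\|_2>0$. Then $\ell_{\mathrm{LS}}$ is $\mathcal{P}$-uniformly calibrated, with $$\delta_{\ell_{\mathrm{LS}}}(\epsilon;\mathcal{P})\ge\frac{\epsilon^2}{B_X^2}>0\quad\text{for all }\epsilon>0.$$
   Context: Setting: $X\subset\mathbb{R}^m$ is non-empty, convex and compact; $f:X\to\mathbb{R}$ is convex and continuous; $W\subseteq\mathbb{R}^k$ and $C\subseteq\mathbb{R}^m$ are measurable. For $d\in\mathbb{R}^m$, $X^*(d):=\operatorname{argmin}_{x\in X}\{f(x)+d^\top x\}$, and $x^*:\mathbb{R}^m\to X$ is a fixed selection, $x^*(d)\in X^*(d)$. The true loss is $L(d,c):=f(x^*(d))+c^\top x^*(d)-\min_{x\in X}\{f(x)+c^\top x\}$. For a distribution $\mathbb{P}$ on $W\times C$, $(w,c)\sim\mathbb{P}$ and $\mathbb{E}[\cdot\mid w]$ denotes integration in $c$ against a fixed regular conditional distribution $\mathbb{P}[\cdot\mid w]$, defined for every $w\in W$. A loss $\ell$ is $\mathcal{P}$-uniformly calibrated if for all $\epsilon>0$ there is $\delta>0$ such that for all $\mathbb{P}\in\mathcal{P}$, $w\in W$, $d\in\mathbb{R}^m$: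 $\mathbb{E}[\ell(d,c)\mid w]-\inf_{d'}\mathbb{E}[\ell(d',c)\mid w]<\delta$ implies $\mathbb{E}[L(d,c)\mid w]-\inf_{d'}\mathbb{E}[L(d',c)\mid w]<\epsilon$. The uniform calibration function is $$\delta_\ell(\epsilon;\mathcal{P}):=\inf_{d\in\mathbb{R}^m,\,w\in W,\,\mathbb{P}\in\mathcal{P}}\left\{\mathbb{E}[\ell(d,c)\mid w]-\min_{d'}\mathbb{E}[\ell(d',c)\mid w]:\ \mathbb{E}[L(d,c)\mid w]-\min_{d'}\mathbb{E}[L(d',c)\mid w]\ge\epsilon\right\},$$ with $\inf\emptyset=+\infty$. *)

theory Defs
  imports "HOL-Probability.Probability"
begin

definition distributions_on ::
  "(real^'k) set \<Rightarrow> (real^'m) set \<Rightarrow> ((real^'k) \<times> (real^'m)) measure set" where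
  "distributions_on W C =
     {P. prob_space P \<and> sets P = sets (restrict_space borel W \<Otimes>\<^sub>M restrict_space borel C)}"

text \<open>A Markov kernel from \<open>W\<close> to \<open>C\<close>, hence a probability measure on \<open>C\<close> for every \<open>w\<close> in \<open>W\<close>
  and not just for almost every one, which disintegrates \<open>P\<close> over its marginal on \<open>W\<close>.\<close>

definition regular_conditional_distribution ::
  "(real^'k) set \<Rightarrow> (real^'m) set \<Rightarrow> ((real^'k) \<times> (real^'m)) measure \<Rightarrow>
   (real^'k \<Rightarrow> (real^'m) measure) \<Rightarrow> bool" where
  "regular_conditional_distribution W C P K \<longleftrightarrow>
     K \<in> restrict_space borel W \<rightarrow>\<^sub>M prob_algebra (restrict_space borel C) \<and>
     (\<forall>A\<in>sets (restrict_space borel W). \<forall>B\<in>sets (restrict_space borel C).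
        emeasure P (A \<times> B) =
          (\<integral>\<^sup>+w\<in>A. emeasure (K w) B \<partial>distr P (restrict_space borel W) fst))"

text \<open>Below, \<open>\<kappa>\<close> assigns to each joint distribution \<open>P\<close> its fixed regular conditional
  distribution: \<open>\<kappa> P w\<close> is the conditional law of \<open>c\<close> given \<open>w\<close>.\<close>

definition cond_risk ::
  "(((real^'k) \<times> (real^'m)) measure \<Rightarrow> real^'k \<Rightarrow> (real^'m) measure) \<Rightarrow>
   (real^'m \<Rightarrow> real^'m \<Rightarrow> real) \<Rightarrow> ((real^'k) \<times> (real^'m)) measure \<Rightarrow>
   real^'k \<Rightarrow> real^'m \<Rightarrow> real" where
  "cond_risk \<kappa> l P w d = (\<integral>c. l d c \<partial>\<kappa> P w)"

text \<open>The infimum is taken in the extended reals, so that it is \<open>-\<infinity>\<close> for a risk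
  that is unbounded below.\<close>

definition excess_cond_risk ::
  "(((real^'k) \<times> (real^'m)) measure \<Rightarrow> real^'k \<Rightarrow> (real^'m) measure) \<Rightarrow>
   (real^'m \<Rightarrow> real^'m \<Rightarrow> real) \<Rightarrow> ((real^'k) \<times> (real^'m)) measure \<Rightarrow>
   real^'k \<Rightarrow> real^'m \<Rightarrow> ereal" where
  "excess_cond_risk \<kappa> l P w d =
     ereal (cond_risk \<kappa> l P w d) - (INF d'. ereal (cond_risk \<kappa> l P w d'))"

definition uniformly_calibrated ::
  "(real^'k) set \<Rightarrow> (((real^'k) \<times> (real^'m)) measure \<Rightarrow> real^'k \<Rightarrow> (real^'m) measure) \<Rightarrow>
   (real^'m \<Rightarrow> real^'m \<Rightarrow> real) \<Rightarrow> ((real^'k) \<times> (real^'m)) measure set \<Rightarrow>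
   (real^'m \<Rightarrow> real^'m \<Rightarrow> real) \<Rightarrow> bool" where
  "uniformly_calibrated W \<kappa> L \<P> l \<longleftrightarrow>
     (\<forall>\<epsilon>::real. \<epsilon> > 0 \<longrightarrow> (\<exists>\<delta>::real. \<delta> > 0 \<and>
        (\<forall>P\<in>\<P>. \<forall>w\<in>W. \<forall>d.
           excess_cond_risk \<kappa> l P w d < ereal \<delta> \<longrightarrow>
           excess_cond_risk \<kappa> L P w d < ereal \<epsilon>)))"

definition calibration_function ::
  "(real^'k) set \<Rightarrow> (((real^'k) \<times> (real^'m)) measure \<Rightarrow> real^'k \<Rightarrow> (real^'m) measure) \<Rightarrow>
   (real^'m \<Rightarrow> real^'m \<Rightarrow> real) \<Rightarrow> (real^'m \<Rightarrow> real^'m \<Rightarrow> real) \<Rightarrow>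
   real \<Rightarrow> ((real^'k) \<times> (real^'m)) measure set \<Rightarrow> ereal" where
  "calibration_function W \<kappa> L l \<epsilon> \<P> =
     Inf {excess_cond_risk \<kappa> l P w d | d w P.
            w \<in> W \<and> P \<in> \<P> \<and> excess_cond_risk \<kappa> L P w d \<ge> ereal \<epsilon>}"

definition argmin_set ::
  "(real^'m) set \<Rightarrow> (real^'m \<Rightarrow> real) \<Rightarrow> real^'m \<Rightarrow> (real^'m) set" where
  "argmin_set X f d = {x. is_arg_min (\<lambda>x. f x + d \<bullet> x) (\<lambda>x. x \<in> X) x}"

definition true_loss ::
  "(real^'m) set \<Rightarrow> (real^'m \<Rightarrow> real) \<Rightarrow> (real^'m \<Rightarrow> real^'m) \<Rightarrow>
   real^'m \<Rightarrow> real^'m \<Rightarrow> real" where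
  "true_loss X f xs d c = f (xs d) + c \<bullet> xs d - (INF x\<in>X. f x + c \<bullet> x)"

definition ls_loss :: "real^'m \<Rightarrow> real^'m \<Rightarrow> real" where
  "ls_loss d c = (norm (d - c))\<^sup>2"

definition square_integrable_class ::
  "(real^'k) set \<Rightarrow> (real^'m) set \<Rightarrow>
   (((real^'k) \<times> (real^'m)) measure \<Rightarrow> real^'k \<Rightarrow> (real^'m) measure) \<Rightarrow>
   ((real^'k) \<times> (real^'m)) measure set" where
  "square_integrable_class W C \<kappa> =
     {P \<in> distributions_on W C. \<forall>w\<in>W.
        integrable (\<kappa> P w) (\<lambda>c. (norm c)\<^sup>2) \<and> (\<integral>c. c \<partial>\<kappa> P w) \<in> convex hull C}"

end

theory Submission
  imports Defs
begin

text \<open>Write \<open>\<mu>\<close> for the conditional mean of \<open>c\<close>. The conditional true risk at \<open>d\<close> is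
  \<open>f (xs d) + \<mu> \<bullet> xs d\<close> up to a term independent of \<open>d\<close>, so it is minimised at \<open>d = \<mu>\<close>, and
  optimality of \<open>xs d\<close> for \<open>d\<close> gives
  \<open>(f (xs d) + \<mu> \<bullet> xs d) - (f (xs \<mu>) + \<mu> \<bullet> xs \<mu>) \<le> (\<mu> - d) \<bullet> (xs d - xs \<mu>)\<close>,
  which is at most \<open>diameter X * norm (d - \<mu>)\<close>. The excess least-squares risk is exactly
  \<open>(norm (d - \<mu>))\<^sup>2\<close>.\<close>

lemma argmin_setD:
  assumes "x \<in> argmin_set X f d"
  shows "x \<in> X" and "y \<in> X \<Longrightarrow> f x + d \<bullet> x \<le> f y + d \<bullet> y"
  using assms by (auto simp: argmin_set_def is_arg_min_linorder)

text \<open>A real infimum has its intended value only for a non-empty set bounded below; attainment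
  by \<open>x\<close> supplies both.\<close>

lemma INF_eq_argmin:
  assumes "x \<in> argmin_set X f d"
  shows "(INF x\<in>X. f x + d \<bullet> x) = f x + d \<bullet> x"
proof (rule cInf_eq_minimum)
  show "f x + d \<bullet> x \<in> (\<lambda>x. f x + d \<bullet> x) ` X"
    using argmin_setD(1)[OF assms] by auto
qed (use argmin_setD(2)[OF assms] in auto)

text \<open>The minimiser at \<open>c'\<close> is feasible at \<open>c\<close>, and its
  \<open>f\<close>-term cancels, so the difference of values is controlled by the norm of a point of
  \<open>X\<close>. The lemma serves to make the optimal value integrable in
  \<open>c\<close>.\<close>

lemma optimal_value_lipschitz:
  assumes xs: "\<And>d. xs d \<in> argmin_set X f d"
    and R: "\<And>x. x \<in> X \<Longrightarrow> norm x \<le> R"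
  shows "R-lipschitz_on UNIV (\<lambda>c. INF x\<in>X. f x + c \<bullet> x)"
proof (rule lipschitz_onI)
  have le: "(INF x\<in>X. f x + c \<bullet> x) - (INF x\<in>X. f x + c' \<bullet> x) \<le> R * norm (c - c')" for c c'
  proof -
    have "f (xs c) + c \<bullet> xs c \<le> f (xs c') + c \<bullet> xs c'"
      using argmin_setD(2)[OF xs[of c] argmin_setD(1)[OF xs[of c']]] .
    then have "(INF x\<in>X. f x + c \<bullet> x) - (INF x\<in>X. f x + c' \<bullet> x) \<le> (c - c') \<bullet> xs c'"
      by (simp add: INF_eq_argmin[OF xs] inner_diff_left)
    also have "\<dots> \<le> norm (c - c') * norm (xs c')"
      by (rule norm_cauchy_schwarz)
    also have "\<dots> \<le> norm (c - c') * R"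
      by (rule mult_left_mono[OF R[OF argmin_setD(1)[OF xs]]]) simp
    finally show ?thesis
      by (simp add: mult.commute)
  qed
  show "dist (INF x\<in>X. f x + c \<bullet> x) (INF x\<in>X. f x + c' \<bullet> x) \<le> R * dist c c'" for c c'
    using le[of c c'] le[of c' c] by (simp add: dist_norm norm_minus_commute abs_le_iff)
  \<comment> \<open>The selection provides a point of \<open>X\<close>, so \<open>R\<close> bounds
    some norm.\<close>
  show "0 \<le> R"
    using order_trans[OF norm_ge_zero R[OF argmin_setD(1)[OF xs]]] .
qed

text \<open>Lipschitz functions are continuous, hence Borel, and grow at most linearly; the constant
  term is integrable because the measure is finite.\<close>

lemma (in prob_space) integrable_lipschitz:
  fixes g :: "'b::{second_countable_topology,banach} \<Rightarrow> real"
  assumes g: "R-lipschitz_on UNIV g" and X: "integrable M X"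
  shows "integrable M (\<lambda>x. g (X x))"
proof (rule Bochner_Integration.integrable_bound)
  show "integrable M (\<lambda>x. \<bar>g 0\<bar> + R * norm (X x))"
    using X by simp
  have "g \<in> borel_measurable borel"
    using lipschitz_on_continuous_on[OF g] by (rule borel_measurable_continuous_onI)
  then show "(\<lambda>x. g (X x)) \<in> borel_measurable M"
    by (rule measurable_compose[OF borel_measurable_integrable[OF X]])
  have "\<bar>g y\<bar> \<le> \<bar>g 0\<bar> + R * norm y" for y
    using lipschitz_onD[OF g, of y 0] by (simp add: dist_norm)
  then show "AE x in M. norm (g (X x)) \<le> norm (\<bar>g 0\<bar> + R * norm (X x))"
    by (intro AE_I2) (metis abs_ge_self order_trans real_norm_def)
qed

lemma (in prob_space) integrable_of_square_integrable:
  fixes X :: "'a \<Rightarrow> 'b::{second_countable_topology,banach}"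
  assumes X: "random_variable borel X" and "integrable M (\<lambda>x. (norm (X x))\<^sup>2)"
  shows "integrable M X"
proof (rule Bochner_Integration.integrable_bound)
  show "integrable M (\<lambda>x. 1 + (norm (X x))\<^sup>2)"
    using assms by simp
  \<comment> \<open>Expanding \<open>(t - 1)\<^sup>2 + t\<^sup>2 \<ge> 0\<close> gives even
    \<open>t \<le> 1/2 + t\<^sup>2\<close>.\<close>
  have "t \<le> 1 + t\<^sup>2" for t :: real
    using sum_power2_ge_zero[of "t - 1" t] by (simp add: power2_eq_square algebra_simps)
  then show "AE x in M. norm (X x) \<le> norm (1 + (norm (X x))\<^sup>2)"
    by (intro AE_I2) (simp add: abs_of_nonneg)
qed (rule X)

text \<open>The loss is affine in \<open>c\<close> apart from the optimal value. Once that value is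
  known to be integrable, linearity splits it off as a term free of \<open>d\<close>.\<close>

lemma expectation_true_loss:
  fixes M :: "(real^'m) measure"
  assumes "prob_space M" and "bounded X" and xs: "\<And>d. xs d \<in> argmin_set X f d"
    and [simp]: "integrable M (\<lambda>c. c)"
  shows "(\<integral>c. true_loss X f xs d c \<partial>M) =
    f (xs d) + (\<integral>c. c \<partial>M) \<bullet> xs d - (\<integral>c. (INF x\<in>X. f x + c \<bullet> x) \<partial>M)"
proof -
  interpret prob_space M by fact
  obtain R where "\<And>x. x \<in> X \<Longrightarrow> norm x \<le> R"
    using \<open>bounded X\<close> by (auto simp: bounded_iff)
  from optimal_value_lipschitz[OF xs this]
  have [simp]: "integrable M (\<lambda>c. INF x\<in>X. f x + c \<bullet> x)"
    by (rule integrable_lipschitz) simp_all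
  show ?thesis
    unfolding true_loss_def[abs_def] by (simp add: prob_space)
qed

text \<open>Bias-variance decomposition: the last summand is the total variance and does not depend
  on \<open>d\<close>.\<close>

lemma expectation_ls_loss:
  fixes M :: "(real^'m) measure"
  assumes "prob_space M" and [simp]: "integrable M (\<lambda>c. c)" "integrable M (\<lambda>c. (norm c)\<^sup>2)"
  shows "(\<integral>c. ls_loss d c \<partial>M) =
    (norm (d - (\<integral>c. c \<partial>M)))\<^sup>2 + (\<integral>c. ls_loss (\<integral>c. c \<partial>M) c \<partial>M)"
proof -
  interpret prob_space M by fact
  \<comment> \<open>Kept general in \<open>a\<close>, since it is applied both at \<open>d\<close>
    and at the mean.\<close>
  have *: "expectation (ls_loss a) =
      (norm a)\<^sup>2 - 2 * (a \<bullet> expectation (\<lambda>c. c)) + expectation (\<lambda>c. (norm c)\<^sup>2)" for a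
  proof -
    have "ls_loss a = (\<lambda>c. (norm a)\<^sup>2 - 2 * (a \<bullet> c) + (norm c)\<^sup>2)"
      by (auto simp: ls_loss_def power2_norm_eq_inner algebra_simps inner_commute)
    then show ?thesis
      by (simp add: prob_space)
  qed
  show ?thesis
    unfolding * by (simp add: power2_norm_eq_inner algebra_simps inner_commute)
qed

text \<open>Any competitor \<open>d'\<close> bounds the infimum from above, even when the infimum is
  -\<infinity>. For the least-squares risk the competitor will be the mean.\<close>

lemma excess_cond_risk_ge:
  "ereal (cond_risk \<kappa> l P w d - cond_risk \<kappa> l P w d') \<le> excess_cond_risk \<kappa> l P w d"
proof -
  have "(INF d'. ereal (cond_risk \<kappa> l P w d')) \<le> ereal (cond_risk \<kappa> l P w d')"
    by (rule INF_lower) simp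
  then show ?thesis
    unfolding excess_cond_risk_def by (metis ereal_minus(1) ereal_minus_mono order_refl)
qed

text \<open>Bounding an excess from above takes an actual minimiser, which also makes the infimum
  finite.\<close>

lemma excess_cond_risk_eq:
  assumes "\<And>d. cond_risk \<kappa> l P w d' \<le> cond_risk \<kappa> l P w d"
  shows "excess_cond_risk \<kappa> l P w d = ereal (cond_risk \<kappa> l P w d - cond_risk \<kappa> l P w d')"
proof -
  have "(INF d'. ereal (cond_risk \<kappa> l P w d')) = ereal (cond_risk \<kappa> l P w d')"
    using assms by (intro antisym INF_lower INF_greatest) auto
  then show ?thesis
    by (simp add: excess_cond_risk_def)
qed

lemma regular_conditional_distributionD:
  assumes "regular_conditional_distribution W C P K" and "w \<in> W"
  shows "prob_space (K w)" and "sets (K w) = sets (restrict_space borel C)"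
proof -
  have "w \<in> space (restrict_space borel W)"
    using assms(2) by (simp add: space_restrict_space)
  then have "K w \<in> space (prob_algebra (restrict_space borel C))"
    using assms(1) unfolding regular_conditional_distribution_def
    by (blast intro: measurable_space)
  then show "prob_space (K w)" and "sets (K w) = sets (restrict_space borel C)"
    by (auto simp: space_prob_algebra)
qed

text \<open>The number \<open>r\<close> is the distance from \<open>d\<close> to the conditional
  mean; it links the two excess risks, linearly in one and quadratically in the other.\<close>

lemma excess_true_risk_le_excess_ls_risk:
  assumes X: "bounded X" and xs: "\<And>d. xs d \<in> argmin_set X f d"
    and P: "P \<in> square_integrable_class W C \<kappa>" and w: "w \<in> W"
    and reg: "regular_conditional_distribution W C P (\<kappa> P)"
  obtains r where "excess_cond_risk \<kappa> (true_loss X f xs) P w d \<le> ereal (diameter X * r)"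
    and "ereal (r\<^sup>2) \<le> excess_cond_risk \<kappa> ls_loss P w d"
proof -
  interpret prob_space "\<kappa> P w"
    using regular_conditional_distributionD(1)[OF reg w] .
  \<comment> \<open>The kernel lives on the Borel sets of \<open>C\<close>, so this is the inclusion
    of \<open>C\<close> into the whole space.\<close>
  have "(\<lambda>c. c) \<in> borel_measurable (\<kappa> P w)"
    using measurable_restrict_space1[OF measurable_ident]
    by (simp add: measurable_cong_sets[OF regular_conditional_distributionD(2)[OF reg w] refl] id_def)
  moreover have i2: "integrable (\<kappa> P w) (\<lambda>c. (norm c)\<^sup>2)"
    using P w by (auto simp: square_integrable_class_def)
  ultimately have i1: "integrable (\<kappa> P w) (\<lambda>c. c)"
    by (rule integrable_of_square_integrable)
  define \<mu> where "\<mu> = expectation (\<lambda>c. c)"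
  define L where "L = cond_risk \<kappa> (true_loss X f xs) P w"
  have L_diff: "L d - L \<mu> = (f (xs d) + \<mu> \<bullet> xs d) - (f (xs \<mu>) + \<mu> \<bullet> xs \<mu>)" for d
    by (simp add: L_def cond_risk_def expectation_true_loss[OF prob_space_axioms X xs i1] \<mu>_def)
  have "L \<mu> \<le> L d" for d
    using L_diff[of d] argmin_setD(2)[OF xs[of \<mu>] argmin_setD(1)[OF xs[of d]]] by linarith
  then have "excess_cond_risk \<kappa> (true_loss X f xs) P w d = ereal (L d - L \<mu>)"
    unfolding L_def by (rule excess_cond_risk_eq)
  moreover have "L d - L \<mu> \<le> diameter X * norm (d - \<mu>)"
  proof -
    have "L d - L \<mu> \<le> (\<mu> - d) \<bullet> (xs d - xs \<mu>)"
      using L_diff[of d] argmin_setD(2)[OF xs[of d] argmin_setD(1)[OF xs[of \<mu>]]]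
      by (simp add: inner_diff_left inner_diff_right)
    also have "\<dots> \<le> norm (\<mu> - d) * norm (xs d - xs \<mu>)"
      by (rule norm_cauchy_schwarz)
    also have "\<dots> \<le> norm (\<mu> - d) * diameter X"
      using diameter_bounded_bound[OF X argmin_setD(1)[OF xs] argmin_setD(1)[OF xs]]
      by (intro mult_left_mono) (auto simp: dist_norm)
    finally show ?thesis
      by (simp add: mult.commute norm_minus_commute)
  qed
  moreover have "ereal ((norm (d - \<mu>))\<^sup>2) \<le> excess_cond_risk \<kappa> ls_loss P w d"
    using excess_cond_risk_ge[of \<kappa> ls_loss P w d \<mu>] expectation_ls_loss[OF prob_space_axioms i1 i2, of d]
    by (simp add: cond_risk_def \<mu>_def)
  ultimately show thesis
    by (intro that[of "norm (d - \<mu>)"]) auto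
qed

theorem theorem4:
  fixes X C :: "(real^'m) set" and W :: "(real^'k) set"
    and f :: "real^'m \<Rightarrow> real" and xs :: "real^'m \<Rightarrow> real^'m"
    and \<kappa> :: "((real^'k) \<times> (real^'m)) measure \<Rightarrow> real^'k \<Rightarrow> (real^'m) measure"
  assumes "X \<noteq> {}" and "convex X" and "compact X"
    and "convex_on X f" and "continuous_on X f"
    and "W \<in> sets borel" and "C \<in> sets borel"
    and "\<And>d. xs d \<in> argmin_set X f d"
    and "\<And>P. P \<in> distributions_on W C \<Longrightarrow> regular_conditional_distribution W C P (\<kappa> P)"
    and "diameter X > 0"
  shows "uniformly_calibrated W \<kappa> (true_loss X f xs) (square_integrable_class W C \<kappa>) ls_loss \<and>
    (\<forall>\<epsilon>::real. \<epsilon> > 0 \<longrightarrow>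
       calibration_function W \<kappa> (true_loss X f xs) ls_loss \<epsilon> (square_integrable_class W C \<kappa>)
         \<ge> ereal (\<epsilon>\<^sup>2 / (diameter X)\<^sup>2) \<and>
       \<epsilon>\<^sup>2 / (diameter X)\<^sup>2 > 0)"
proof -
  let ?D = "diameter X" and ?L = "true_loss X f xs" and ?P = "square_integrable_class W C \<kappa>"
  \<comment> \<open>Both conclusions follow from this: its contrapositive is calibration, and it
    bounds every element of the set defining the calibration function.\<close>
  have ls_ge: "ereal (\<epsilon>\<^sup>2 / ?D\<^sup>2) \<le> excess_cond_risk \<kappa> ls_loss P w d"
    if \<epsilon>: "0 < \<epsilon>" and P: "P \<in> ?P" and w: "w \<in> W" and ge: "ereal \<epsilon> \<le> excess_cond_risk \<kappa> ?L P w d" for \<epsilon> P w d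
  proof -
    have "regular_conditional_distribution W C P (\<kappa> P)"
      using P assms(9) by (simp add: square_integrable_class_def)
    then obtain r where r: "excess_cond_risk \<kappa> ?L P w d \<le> ereal (?D * r)"
        "ereal (r\<^sup>2) \<le> excess_cond_risk \<kappa> ls_loss P w d"
      by (rule excess_true_risk_le_excess_ls_risk[OF compact_imp_bounded[OF assms(3)] assms(8) P w])
    have "\<epsilon> \<le> ?D * r"
      using order_trans[OF ge r(1)] by simp
    then have "\<epsilon> / ?D \<le> r"
      using assms(10) by (simp add: divide_le_eq mult.commute)
    \<comment> \<open>Squaring preserves the order because the left side is non-negative.\<close>
    then have "(\<epsilon> / ?D)\<^sup>2 \<le> r\<^sup>2"
      using \<epsilon> assms(10) by (intro power_mono) auto
    then show ?thesis
      by (intro order_trans[OF _ r(2)]) (simp add: power_divide)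
  qed
  have pos: "0 < \<epsilon>\<^sup>2 / ?D\<^sup>2" if "0 < \<epsilon>" for \<epsilon>
    using that assms(10) by simp
  have "uniformly_calibrated W \<kappa> ?L ?P ls_loss"
    unfolding uniformly_calibrated_def
  proof (intro allI impI exI conjI ballI)
    \<comment> \<open>This fixes \<delta> as the bound of \<open>ls_ge\<close>, which depends only
      on \<epsilon> and \<open>X\<close> and is thus uniform in \<open>P\<close>, \<open>w\<close>
      and \<open>d\<close>.\<close>
    show "0 < \<epsilon>\<^sup>2 / ?D\<^sup>2" if "0 < \<epsilon>" for \<epsilon>
      using pos[OF that] .
    show "excess_cond_risk \<kappa> ?L P w d < ereal \<epsilon>"
      if "0 < \<epsilon>" "P \<in> ?P" "w \<in> W" "excess_cond_risk \<kappa> ls_loss P w d < ereal (\<epsilon>\<^sup>2 / ?D\<^sup>2)"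
      for \<epsilon> P w d
      using ls_ge[OF that(1-3), of d] that(4) unfolding not_le[symmetric] by blast
  qed
  moreover have "ereal (\<epsilon>\<^sup>2 / ?D\<^sup>2) \<le> calibration_function W \<kappa> ?L ls_loss \<epsilon> ?P" if "0 < \<epsilon>" for \<epsilon>
    \<comment> \<open>An empty set causes no exception, its infimum in the extended reals being
      +\<infinity>.\<close>
    unfolding calibration_function_def using ls_ge[OF that] by (auto intro!: Inf_greatest)
  ultimately show ?thesis
    using pos by auto
qed

end
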